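(* Consider the RMDA algorithm (defined in the context). Assume the following. (i) $\sum_{t\ge 1} c_t=\infty$. (ii) There is $L$ such that, for $\xi\sim\mathcal D$, $f_\xi$ is almost surely differentiable with $L$-Lipschitz-continuous gradient (so $f$ is also differentiable with $L$-Lipschitz-continuous gradient). (iii) There is $C\ge 0$ such that $\mathbb E_{\xi_t\sim\mathcal D}\|\nabla f_{\xi_t}(W^{t-1})\|^2\le C$ for all $t$. (iv) $\sum_t \beta_t\eta_t\alpha_t^{-1}=\infty$, $\ \sum_t(\beta_t\eta_t\alpha_t^{-1})^2<\infty$, and $\ \|W^{t+1}-W^t\|\,(\beta_t\eta_t\alpha_t^{-1})^{-1}\to 0$ almost surely. (v) The set of stationary points $\mathcal Z:=\{W\in\mathcal E\mid 0\in\partial F(W)\}$ is nonempty. (vi) $\beta_t\alpha_t^{-1}\to 0$. For any given $W^0$ and any point $W^*\in\mathcal E$, consider the event that $\{\tilde W^t\}$ converges to $W^*$. If $\partial\psi$ is outer semicontinuous at $W^*$ and this event has nonzero probability, then, with probability one conditional on this event, $W^*\in\mathcal Z$; that is, $W^*$ is a stationary point of $F$.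
   Context: **Problem.** $\mathcal E$ is a Euclidean space with inner product $\langle\cdot,\cdot\rangle$ and induced norm $\|\cdot\|$. $\mathcal D$ is a probability distribution over a space $\Omega$. For $\xi\in\Omega$, $f_\xi:\mathcal E\to\mathbb R$ is a function that is differentiable almost everywhere with gradient $\nabla f_\xi$. Put $f(W):=\mathbb E_{\xi\sim\mathcal D}[f_\xi(W)]$. The regularizer $\psi:\mathcal E\to(-\infty,\infty]$ may be nondifferentiable and nonconvex. The objective is $F:=f+\psi$. **RMDA algorithm.** Given $W^0\in\mathcal E$, learning rates $\eta_t>0$ and factors $c_t\in[0,1]$ ($t\ge 1$), set $V^0=0$, $\alpha_0=0$, and for $t=1,2,\dots$: - $\beta_t=\sqrt t$ and $\alpha_t=\alpha_{t-1}+\beta_t\eta_t$ (so $\alpha_t=\sum_{k=1}^t\beta_k\eta_k$); - draw $\xi_t\sim\mathcal D$ independently of the past and set $V^t=V^{t-1}+\beta_t\eta_t\nabla f_{\xi_t}(W^{t-1})$; - $\tilde W^t\in\operatorname{argmin}_{W}\ \langle V^t,W\rangle+\frac{\beta_t}{2}\|W-W^0\|^2+\alpha_t\psi(W)$; - $W^t=(1-c_t)W^{t-1}+c_t\tilde W^t$. $\mathbb E_{\xi_t\sim\mathcal D}$ denotes expectation over the fresh sample $\xi_t$, with $W^{t-1}$ held fixed (i.e. conditional on the past). $\partial\psi$ and $\partial F$ denote regular (Fréchet) subdifferentials. $\partial\psi$ is *outer semicontinuous* at $W^*$ if $W_k\to W^*$, $U_k\in\partial\psi(W_k)$, $U_k\to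 U$ imply $U\in\partial\psi(W^* )$. *)

theory Defs
  imports "HOL-Probability.Probability"
begin

section \<open>Gradients and regular subdifferentials\<close>

(* Meaningful only where h is differentiable (unspecified value elsewhere). *)
definition gradient :: "('a::euclidean_space \<Rightarrow> real) \<Rightarrow> 'a \<Rightarrow> 'a" where
  "gradient h x = (THE v. GDERIV h x :> v)"

(* v is a regular subgradient at x iff g x is finite and
   g y >= g x + <v, y - x> + o(norm (y - x)) as y tends to x.
   The set is empty where g is infinite. *)
definition regular_subdifferential :: "('a::euclidean_space \<Rightarrow> ereal) \<Rightarrow> 'a \<Rightarrow> 'a set" where
  "regular_subdifferential g x =
     {v. \<bar>g x\<bar> \<noteq> \<infinity> \<and>
         0 \<le> Liminf (at x) (\<lambda>y. (g y - g x - ereal (v \<bullet> (y - x))) / ereal (norm (y - x)))}"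

definition outer_semicontinuous_at ::
    "('a::topological_space \<Rightarrow> 'b::topological_space set) \<Rightarrow> 'a \<Rightarrow> bool" where
  "outer_semicontinuous_at S x \<longleftrightarrow>
     (\<forall>w u l. w \<longlonglongrightarrow> x \<and> (\<forall>k. u k \<in> S (w k)) \<and> u \<longlonglongrightarrow> l \<longrightarrow> l \<in> S x)"

section \<open>The regularized stochastic problem\<close>

definition expected_loss :: "'w measure \<Rightarrow> ('w \<Rightarrow> 'a \<Rightarrow> real) \<Rightarrow> 'a \<Rightarrow> real" where
  "expected_loss D f w = (\<integral>\<xi>. f \<xi> w \<partial>D)"

definition objective ::
    "'w measure \<Rightarrow> ('w \<Rightarrow> 'a \<Rightarrow> real) \<Rightarrow> ('a \<Rightarrow> ereal) \<Rightarrow> 'a \<Rightarrow> ereal" where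
  "objective D f \<psi> w = ereal (expected_loss D f w) + \<psi> w"

definition stationary_points ::
    "'w measure \<Rightarrow> ('w \<Rightarrow> 'a::euclidean_space \<Rightarrow> real) \<Rightarrow> ('a \<Rightarrow> ereal) \<Rightarrow> 'a set" where
  "stationary_points D f \<psi> = {w. 0 \<in> regular_subdifferential (objective D f \<psi>) w}"

(* Integrability says that the expectation defining f(W) exists as a real number;
   otherwise the Bochner integral would silently be 0. *)
definition stochastic_problem ::
    "'w measure \<Rightarrow> ('w \<Rightarrow> 'a::euclidean_space \<Rightarrow> real) \<Rightarrow> ('a \<Rightarrow> ereal) \<Rightarrow> bool" where
  "stochastic_problem D f \<psi> \<longleftrightarrow>
     prob_space D \<and>
     (\<forall>\<xi>\<in>space D. AE w in lborel. f \<xi> differentiable (at w)) \<and>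
     (\<forall>w. integrable D (\<lambda>\<xi>. f \<xi> w)) \<and>
     (\<forall>w. \<psi> w \<noteq> -\<infinity>)"

section \<open>The RMDA algorithm\<close>

definition rmda_beta :: "nat \<Rightarrow> real" where
  "rmda_beta t = sqrt (real t)"

definition rmda_alpha :: "(nat \<Rightarrow> real) \<Rightarrow> nat \<Rightarrow> real" where
  "rmda_alpha \<eta> t = (\<Sum>k=1..t. rmda_beta k * \<eta> k)"

definition rmda_subproblem ::
    "('a::euclidean_space \<Rightarrow> ereal) \<Rightarrow> 'a \<Rightarrow> (nat \<Rightarrow> real) \<Rightarrow> nat \<Rightarrow> 'a \<Rightarrow> 'a \<Rightarrow> ereal" where
  "rmda_subproblem \<psi> W0 \<eta> t v w =
     ereal (v \<bullet> w + rmda_beta t / 2 * (norm (w - W0))\<^sup>2) + ereal (rmda_alpha \<eta> t) * \<psi> w"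

(* One realization of the algorithm along a fixed sample sequence \<xi>; Wt is the sequence
   of (arbitrarily selected) subproblem minimizers. *)
definition rmda_trajectory ::
    "('w \<Rightarrow> 'a::euclidean_space \<Rightarrow> real) \<Rightarrow> ('a \<Rightarrow> ereal) \<Rightarrow> 'a \<Rightarrow> (nat \<Rightarrow> real) \<Rightarrow> (nat \<Rightarrow> real)
      \<Rightarrow> (nat \<Rightarrow> 'w) \<Rightarrow> (nat \<Rightarrow> 'a) \<Rightarrow> (nat \<Rightarrow> 'a) \<Rightarrow> (nat \<Rightarrow> 'a) \<Rightarrow> bool" where
  "rmda_trajectory f \<psi> W0 \<eta> c \<xi> V Wt W \<longleftrightarrow>
     W 0 = W0 \<and> V 0 = 0 \<and>
     (\<forall>t\<ge>1. V t = V (t - 1) + (rmda_beta t * \<eta> t) *\<^sub>R gradient (f (\<xi> t)) (W (t - 1)) \<and>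
            is_arg_min (rmda_subproblem \<psi> W0 \<eta> t (V t)) (\<lambda>_. True) (Wt t) \<and>
            W t = (1 - c t) *\<^sub>R W (t - 1) + c t *\<^sub>R Wt t)"

(* The sigma-algebra of everything random before round t. The minimizers are included
   because ties in the argmin may be broken at random; V and W are determined
   by the samples and the minimizers. *)
definition rmda_past ::
    "'m measure \<Rightarrow> 'w measure \<Rightarrow> (nat \<Rightarrow> 'm \<Rightarrow> 'w) \<Rightarrow> (nat \<Rightarrow> 'm \<Rightarrow> 'a::euclidean_space) \<Rightarrow> nat
      \<Rightarrow> 'm measure" where
  "rmda_past M D \<xi> Wt t =
     vimage_algebra (space M) (\<lambda>\<omega>. \<lambda>s\<in>{1..<t}. (\<xi> s \<omega>, Wt s \<omega>))
       (\<Pi>\<^sub>M s\<in>{1..<t}. D \<Otimes>\<^sub>M borel)"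

(* The recursion is required almost surely only, since the gradient of f_xi
   need exist only for almost every xi. *)
definition rmda_process ::
    "'m measure \<Rightarrow> 'w measure \<Rightarrow> ('w \<Rightarrow> 'a::euclidean_space \<Rightarrow> real) \<Rightarrow> ('a \<Rightarrow> ereal) \<Rightarrow> 'a
      \<Rightarrow> (nat \<Rightarrow> real) \<Rightarrow> (nat \<Rightarrow> real)
      \<Rightarrow> (nat \<Rightarrow> 'm \<Rightarrow> 'w) \<Rightarrow> (nat \<Rightarrow> 'm \<Rightarrow> 'a) \<Rightarrow> (nat \<Rightarrow> 'm \<Rightarrow> 'a) \<Rightarrow> (nat \<Rightarrow> 'm \<Rightarrow> 'a) \<Rightarrow> bool" where
  "rmda_process M D f \<psi> W0 \<eta> c \<xi> V Wt W \<longleftrightarrow>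
     prob_space M \<and>
     (\<forall>t\<ge>1. \<xi> t \<in> M \<rightarrow>\<^sub>M D \<and> distr M D (\<xi> t) = D \<and> Wt t \<in> borel_measurable M \<and>
        prob_space.indep_set M (sets (vimage_algebra (space M) (\<xi> t) D))
          (sets (rmda_past M D \<xi> Wt t))) \<and>
     (AE \<omega> in M. rmda_trajectory f \<psi> W0 \<eta> c
        (\<lambda>t. \<xi> t \<omega>) (\<lambda>t. V t \<omega>) (\<lambda>t. Wt t \<omega>) (\<lambda>t. W t \<omega>))"

end

theory Submission
  imports Defs
begin

text \<open>
  Put \<open>\<gamma>\<^sub>t = \<beta>\<^sub>t \<eta>\<^sub>t / \<alpha>\<^sub>t\<close>. Then \<open>V\<^sup>t / \<alpha>\<^sub>t\<close> is the running average with weights \<open>\<gamma>\<^sub>t\<close>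
  of the sampled gradients \<open>\<nabla>f\<^bsub>\<xi>\<^sub>t\<^esub>(W\<^bsup>t-1\<^esup>)\<close>. Split each of these at \<open>W\<^sup>*\<close>. On the event
  \<open>W\<^sup>t\<close> also tends to \<open>W\<^sup>*\<close>, so by the Lipschitz condition the differences
  \<open>\<nabla>f\<^bsub>\<xi>\<^sub>t\<^esub>(W\<^bsup>t-1\<^esup>) - \<nabla>f\<^bsub>\<xi>\<^sub>t\<^esub>(W\<^sup>*)\<close> vanish along every path. What remains,
  \<open>\<nabla>f\<^bsub>\<xi>\<^sub>t\<^esub>(W\<^sup>*) - \<nabla>f(W\<^sup>*)\<close>, is centered, pairwise independent and has a fixed finite variance;
  its running average tends to 0 in mean square, hence almost surely along a subsequence. So
  \<open>V\<^sup>t / \<alpha>\<^sub>t\<close> tends to \<open>\<nabla>f(W\<^sup>*)\<close> along a subsequence, which is all that outer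
  semicontinuity needs: the optimality condition
  \<open>- V\<^sup>t / \<alpha>\<^sub>t - (\<beta>\<^sub>t / \<alpha>\<^sub>t) (w - W\<^sup>0) \<in> \<partial>\<psi>(w)\<close> for the minimizer \<open>w\<close> of round
  \<open>t\<close> passes to the limit. The conclusion does not involve the sample point, so a single good
  path in the event suffices.
\<close>

section \<open>Weighted averages\<close>

text \<open>Once \<open>b n\<close> stays below \<open>e / 2\<close>, the excess of
  \<open>a n\<close> over \<open>e / 2\<close> shrinks by a factor \<open>1 - c n\<close>, hence by
  \<open>exp (- c n)\<close>, in every step. Divergence of the sum of \<open>c\<close> drives the
  product of these factors to 0.\<close>

lemma averaging_tendsto_0:
  fixes a b c :: "nat \<Rightarrow> real"
  assumes a_nonneg: "\<And>n. 0 \<le> a n"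
    and rec: "\<And>n. a (Suc n) \<le> (1 - c n) * a n + c n * b n"
    and c01: "\<And>n. 0 \<le> c n" "\<And>n. c n \<le> 1"
    and c_sum: "filterlim (\<lambda>n. \<Sum>k<n. c k) at_top sequentially"
    and b_lim: "b \<longlonglongrightarrow> 0"
  shows "a \<longlonglongrightarrow> 0"
proof (rule tendstoI)
  fix e :: real assume "0 < e"
  then have "eventually (\<lambda>n. b n < e / 2) sequentially"
    using order_tendstoD(2)[OF b_lim, of "e / 2"] by simp
  then obtain N where N: "\<And>n. n \<ge> N \<Longrightarrow> b n < e / 2"
    by (auto simp: eventually_sequentially)
  \<comment> \<open>The positive part keeps the recursion homogeneous: the right-hand side
    \<open>(1 - c n) * u n\<close> is nonnegative, so the contraction survives the
    truncation.\<close>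
  define u where "u n = max 0 (a n - e / 2)" for n
  have u_step: "u (Suc n) \<le> exp (- c n) * u n" if "n \<ge> N" for n
  proof -
    have "a (Suc n) - e / 2 \<le> (1 - c n) * (a n - e / 2)"
      using rec[of n] mult_left_mono[OF less_imp_le[OF N[OF that]] c01(1)[of n]]
      by (simp add: field_simps)
    also have "\<dots> \<le> (1 - c n) * u n"
      using c01(2)[of n] by (intro mult_left_mono) (auto simp: u_def)
    finally have "u (Suc n) \<le> (1 - c n) * u n"
      using c01(2)[of n] by (simp add: u_def)
    also have "\<dots> \<le> exp (- c n) * u n"
      using exp_ge_add_one_self[of "- c n"] by (intro mult_right_mono) (auto simp: u_def)
    finally show ?thesis .
  qed
  \<comment> \<open>The product of \<open>exp (- c k)\<close> over \<open>N \<le> k < n\<close> is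
    written as the exponential of a difference of partial sums, so that \<open>c_sum\<close>
    applies.\<close>
  have u_bound: "u n \<le> exp ((\<Sum>k<N. c k) - (\<Sum>k<n. c k)) * u N" if "n \<ge> N" for n
    using that
  proof (induction n rule: dec_induct)
    case (step n)
    have "u (Suc n) \<le> exp (- c n) * (exp ((\<Sum>k<N. c k) - (\<Sum>k<n. c k)) * u N)"
      using u_step[OF step.hyps(1)] mult_left_mono[OF step.IH, of "exp (- c n)"]
      by (meson exp_ge_zero order_trans)
    then show ?case
      by (simp add: mult.assoc[symmetric] exp_add[symmetric] algebra_simps)
  qed simp
  have "filterlim (\<lambda>n. - (\<Sum>k<N. c k) + (\<Sum>k<n. c k)) at_top sequentially"
    by (intro filterlim_tendsto_add_at_top[OF tendsto_const] c_sum)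
  then have "filterlim (\<lambda>n. (\<Sum>k<N. c k) - (\<Sum>k<n. c k)) at_bot sequentially"
    by (simp add: filterlim_uminus_at_top)
  then have "(\<lambda>n. exp ((\<Sum>k<N. c k) - (\<Sum>k<n. c k)) * u N) \<longlonglongrightarrow> 0 * u N"
    by (intro tendsto_mult tendsto_const filterlim_compose[OF exp_at_bot])
  then have "eventually (\<lambda>n. exp ((\<Sum>k<N. c k) - (\<Sum>k<n. c k)) * u N < e / 2) sequentially"
    using \<open>0 < e\<close> by (intro order_tendstoD(2)) auto
  then show "eventually (\<lambda>n. dist (a n) 0 < e) sequentially"
    using eventually_ge_at_top[of N]
  proof eventually_elim
    case (elim n)
    then have "u n < e / 2" using u_bound[of n] by simp
    then show ?case using a_nonneg[of n] by (auto simp: u_def max_def split: if_splits)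
  qed
qed

text \<open>The triangle inequality reduces this to the scalar case for the distances to
  \<open>l\<close>. It serves both the iterates \<open>W\<close>, driven by the minimizers, and the
  averaged gradients; in either case the starting value is forgotten.\<close>

lemma averaging_vector_tendsto:
  fixes x y :: "nat \<Rightarrow> 'a::real_normed_vector"
  assumes rec: "\<And>n. x (Suc n) = (1 - c n) *\<^sub>R x n + c n *\<^sub>R y n"
    and c01: "\<And>n. 0 \<le> c n" "\<And>n. c n \<le> 1"
    and c_sum: "filterlim (\<lambda>n. \<Sum>k<n. c k) at_top sequentially"
    and y_lim: "y \<longlonglongrightarrow> l"
  shows "x \<longlonglongrightarrow> l"
proof -
  have "(\<lambda>n. norm (x n - l)) \<longlonglongrightarrow> 0"
  proof (rule averaging_tendsto_0[OF _ _ c01 c_sum])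
    fix n
    have "x (Suc n) - l = (1 - c n) *\<^sub>R (x n - l) + c n *\<^sub>R (y n - l)"
      by (simp add: rec algebra_simps)
    then show "norm (x (Suc n) - l) \<le> (1 - c n) * norm (x n - l) + c n * norm (y n - l)"
      using c01[of n] norm_triangle_ineq[of "(1 - c n) *\<^sub>R (x n - l)" "c n *\<^sub>R (y n - l)"]
      by simp
  next
    show "(\<lambda>n. norm (y n - l)) \<longlonglongrightarrow> 0"
      using y_lim by (simp add: tendsto_norm_zero_iff LIM_zero_iff)
  qed simp
  then show ?thesis
    by (simp add: tendsto_norm_zero_iff LIM_zero_iff)
qed

section \<open>Regular subgradients\<close>

text \<open>Removes subtraction and division in \<open>ereal\<close> from all later arguments. The
  hypotheses exclude \<open>\<infinity> - \<infinity>\<close> and the value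
  \<open>-\<infinity>\<close>; where \<open>g y = \<infinity>\<close>, both forms of the inequality
  hold trivially.\<close>

lemma regular_subdifferential_iff:
  assumes fin: "\<bar>g x\<bar> \<noteq> \<infinity>" and ninf: "\<And>y. g y \<noteq> -\<infinity>"
  shows "v \<in> regular_subdifferential g x \<longleftrightarrow>
    (\<forall>e>0. \<forall>\<^sub>F y in at x. g x + ereal (v \<bullet> (y - x) - e * norm (y - x)) \<le> g y)"
    (is "_ \<longleftrightarrow> ?R")
proof -
  obtain r where r: "g x = ereal r" using fin by auto
  define q where "q y = (g y - g x - ereal (v \<bullet> (y - x))) / ereal (norm (y - x))" for y
  have q_ge: "- ereal e \<le> q y \<longleftrightarrow> g x + ereal (v \<bullet> (y - x) - e * norm (y - x)) \<le> g y"
    if "y \<noteq> x" for y e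
  proof (cases "g y")
    case (real s)
    have "- e \<le> (s - r - v \<bullet> (y - x)) / norm (y - x) \<longleftrightarrow> r + (v \<bullet> (y - x) - e * norm (y - x)) \<le> s"
      using that by (subst pos_le_divide_eq) (auto simp: algebra_simps)
    then show ?thesis using that by (simp add: q_def r real)
  qed (use that ninf in \<open>auto simp: q_def r\<close>)
  have neq: "\<forall>\<^sub>F y in at x. y \<noteq> x"
    by (simp add: eventually_at_filter)
  have "0 \<le> Liminf (at x) q \<longleftrightarrow> (\<forall>e>0. \<forall>\<^sub>F y in at x. - ereal e \<le> q y)"
  proof
    assume *: "0 \<le> Liminf (at x) q"
    show "\<forall>e>0. \<forall>\<^sub>F y in at x. - ereal e \<le> q y"
    proof (intro allI impI)
      fix e :: real assume "0 < e"
      then have "\<forall>\<^sub>F y in at x. - ereal e < q y" using * by (auto simp: le_Liminf_iff)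
      then show "\<forall>\<^sub>F y in at x. - ereal e \<le> q y" by eventually_elim simp
    qed
  next
    assume *: "\<forall>e>0. \<forall>\<^sub>F y in at x. - ereal e \<le> q y"
    show "0 \<le> Liminf (at x) q"
      unfolding le_Liminf_iff
    proof (intro allI impI)
      fix z :: ereal assume "z < 0"
      \<comment> \<open>A real number between \<open>z\<close> and 0 also covers
        \<open>z = -\<infinity>\<close>; its negative is the \<open>e\<close> to be used.\<close>
      then obtain d where d: "z < ereal d" "ereal d < 0" by (metis ereal_dense2)
      then have "\<forall>\<^sub>F y in at x. - ereal (- d) \<le> q y"
        using * by (intro *[rule_format]) simp
      then show "\<forall>\<^sub>F y in at x. z < q y"
        by eventually_elim (use d in \<open>auto elim: less_le_trans\<close>)
    qed
  qed
  also have "\<dots> \<longleftrightarrow> ?R"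
  proof -
    have "(\<forall>\<^sub>F y in at x. - ereal e \<le> q y) \<longleftrightarrow>
          (\<forall>\<^sub>F y in at x. g x + ereal (v \<bullet> (y - x) - e * norm (y - x)) \<le> g y)" for e
      by (rule eventually_cong[OF neq q_ge])
    then show ?thesis by simp
  qed
  finally show ?thesis
    using fin by (simp add: regular_subdifferential_def q_def[abs_def])
qed

text \<open>The first-order expansion of \<open>h\<close> and the subgradient inequality of
  \<open>g\<close>, each with error \<open>e / 2\<close>, add up to the required inequality.\<close>

lemma regular_subdifferential_add_smooth:
  fixes h :: "'a::euclidean_space \<Rightarrow> real"
  assumes h: "GDERIV h x :> d" and v: "v \<in> regular_subdifferential g x"
    and ninf: "\<And>y. g y \<noteq> -\<infinity>"
  shows "d + v \<in> regular_subdifferential (\<lambda>y. ereal (h y) + g y) x"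
proof -
  have fin: "\<bar>g x\<bar> \<noteq> \<infinity>" using v by (simp add: regular_subdifferential_def)
  then obtain r where r: "g x = ereal r" by auto
  have ninf': "ereal (h y) + g y \<noteq> -\<infinity>" for y using ninf[of y] by simp
  have fin': "\<bar>ereal (h x) + g x\<bar> \<noteq> \<infinity>" by (simp add: r)
  show ?thesis
    unfolding regular_subdifferential_iff[where g = "\<lambda>y. ereal (h y) + g y", OF fin' ninf']
  proof (intro allI impI)
    fix e :: real assume e: "0 < e"
    have "\<forall>\<^sub>F y in at x. norm (h y - h x - (y - x) \<bullet> d) \<le> e / 2 * norm (y - x)"
    proof -
      obtain \<delta> where "\<delta> > 0"
        "\<And>y. norm (y - x) < \<delta> \<Longrightarrow> norm (h y - h x - (y - x) \<bullet> d) \<le> e / 2 * norm (y - x)"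
        using h e half_gt_zero[of e] unfolding gderiv_def has_derivative_within_alt by blast
      then show ?thesis
        unfolding eventually_at dist_norm by blast
    qed
    moreover have "\<forall>\<^sub>F y in at x. g x + ereal (v \<bullet> (y - x) - e / 2 * norm (y - x)) \<le> g y"
      using v e unfolding regular_subdifferential_iff[where g = g, OF fin ninf]
      by (metis half_gt_zero)
    ultimately show "\<forall>\<^sub>F y in at x. ereal (h x) + g x +
        ereal ((d + v) \<bullet> (y - x) - e * norm (y - x)) \<le> ereal (h y) + g y"
    proof eventually_elim
      case (elim y)
      show ?case
      proof (cases "g y")
        case (real s)
        show ?thesis
        proof -
          have "h x + (y - x) \<bullet> d - e / 2 * norm (y - x) \<le> h y"
            using elim(1) unfolding real_norm_def abs_le_iff by linarith
          moreover have "r + (v \<bullet> (y - x) - e / 2 * norm (y - x)) \<le> s"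
            using elim(2) by (simp add: r real)
          ultimately have "h x + r + ((d + v) \<bullet> (y - x) - e * norm (y - x)) \<le> h y + s"
            unfolding inner_add_left inner_commute[of d] by simp
          then show ?thesis by (simp add: r real)
        qed
      qed (use ninf in \<open>auto simp: r\<close>)
    qed
  qed
qed

text \<open>The optimality condition is read off from minimality itself: expanding the proximal
  square around \<open>x\<close> leaves, besides linear terms, only a multiple of
  \<open>(norm (y - x))\<^sup>2\<close>, which is of smaller order than \<open>norm (y - x)\<close>.
  Division by \<alpha> then isolates \<psi>.\<close>

lemma rmda_subproblem_subgradient:
  fixes \<psi> :: "'a::euclidean_space \<Rightarrow> ereal"
  assumes min: "is_arg_min (rmda_subproblem \<psi> W0 \<eta> t v) (\<lambda>_. True) x"
    and alpha: "0 < rmda_alpha \<eta> t"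
    and ninf: "\<And>y. \<psi> y \<noteq> -\<infinity>" and proper: "\<psi> z \<noteq> \<infinity>"
  shows "- (v /\<^sub>R rmda_alpha \<eta> t) - (rmda_beta t / rmda_alpha \<eta> t) *\<^sub>R (x - W0)
           \<in> regular_subdifferential \<psi> x"
proof -
  define A B where "A = rmda_alpha \<eta> t" and "B = rmda_beta t"
  define u where "u = - (v /\<^sub>R A) - (B / A) *\<^sub>R (x - W0)"
  have A: "0 < A" using alpha by (simp add: A_def)
  have le: "ereal (v \<bullet> x + B / 2 * (norm (x - W0))\<^sup>2) + ereal A * \<psi> x
      \<le> ereal (v \<bullet> y + B / 2 * (norm (y - W0))\<^sup>2) + ereal A * \<psi> y" for y
    using min by (auto simp: is_arg_min_def rmda_subproblem_def A_def B_def not_less)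
  \<comment> \<open>An infinite value at \<open>x\<close> would lose against the finite value at
    \<open>z\<close>.\<close>
  have fin: "\<bar>\<psi> x\<bar> \<noteq> \<infinity>"
    using le[of z] ninf[of x] ninf[of z] proper A by (cases "\<psi> x"; cases "\<psi> z") auto
  then obtain r where r: "\<psi> x = ereal r" by auto
  have "\<forall>\<^sub>F y in at x. \<psi> x + ereal (u \<bullet> (y - x) - e * norm (y - x)) \<le> \<psi> y"
    if "0 < e" for e
  proof -
    \<comment> \<open>On this neighbourhood the quadratic remainder, divided by \<open>A\<close>, is
      at most \<open>e * norm (y - x)\<close>.\<close>
    have "((\<lambda>y. B / (2 * A) * norm (y - x)) \<longlongrightarrow> B / (2 * A) * norm (x - x)) (at x)"
      by (intro tendsto_intros)
    then have "\<forall>\<^sub>F y in at x. B / (2 * A) * norm (y - x) < e"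
      using \<open>0 < e\<close> by (intro order_tendstoD(2)) auto
    then show ?thesis
    proof eventually_elim
      case (elim y)
      show ?case
      proof (cases "\<psi> y")
        case (real s)
        have eq: "(norm (y - W0))\<^sup>2 = (norm (x - W0))\<^sup>2 + 2 * ((x - W0) \<bullet> (y - x)) + (norm (y - x))\<^sup>2"
          by (simp add: power2_norm_eq_inner algebra_simps inner_commute)
        have "v \<bullet> x + B / 2 * (norm (x - W0))\<^sup>2 + A * r \<le> v \<bullet> y + B / 2 * (norm (y - W0))\<^sup>2 + A * s"
          using le[of y] by (simp add: r real)
        then have "A * r \<le> v \<bullet> (y - x) + B * ((x - W0) \<bullet> (y - x)) + B / 2 * (norm (y - x))\<^sup>2 + A * s"
          unfolding eq by (simp add: inner_diff_right algebra_simps)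
        moreover have "A * (u \<bullet> (y - x)) = - (v \<bullet> (y - x)) - B * ((x - W0) \<bullet> (y - x))"
          using A unfolding u_def inner_diff_left[of _ _ "y - x"] inner_minus_left inner_scaleR_left
          by (simp add: right_diff_distrib)
        moreover have "B / 2 * (norm (y - x))\<^sup>2 \<le> A * (e * norm (y - x))"
        proof -
          have "A * ((B / (2 * A) * norm (y - x)) * norm (y - x)) \<le> A * (e * norm (y - x))"
            using elim A by (intro mult_left_mono mult_right_mono) auto
          then show ?thesis using A by (simp add: power2_eq_square field_simps)
        qed
        ultimately have "A * (r + (u \<bullet> (y - x) - e * norm (y - x))) \<le> A * s"
          by (simp add: algebra_simps)
        then show ?thesis using A by (simp add: r real)
      qed (use ninf in \<open>auto simp: r\<close>)
    qed
  qed
  then show ?thesis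
    using fin by (simp add: regular_subdifferential_iff[where g = \<psi>, OF fin ninf] u_def A_def B_def)
qed

section \<open>Gradients of expected losses\<close>

lemma gradient_eq: "GDERIV h x :> d \<Longrightarrow> gradient h x = d"
  unfolding gradient_def
proof (rule the_equality)
  fix v assume "GDERIV h x :> d" "GDERIV h x :> v"
  then have "(\<lambda>z. z \<bullet> d) = (\<lambda>z. z \<bullet> v)"
    unfolding gderiv_def by (rule has_derivative_unique)
  then show "v = d" by (metis vector_eq_ldot inner_commute)
qed

lemma GDERIV_gradient:
  fixes h :: "'a::euclidean_space \<Rightarrow> real"
  assumes "h differentiable (at x)"
  shows "GDERIV h x :> gradient h x"
proof -
  obtain h' where h': "(h has_derivative h') (at x)"
    using assms by (auto simp: differentiable_def)
  interpret linear h' using h' by (rule has_derivative_linear)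
  have "h' z = z \<bullet> (\<Sum>b\<in>Basis. h' b *\<^sub>R b)" for z
  proof -
    have "h' z = h' (\<Sum>b\<in>Basis. (z \<bullet> b) *\<^sub>R b)" by (simp add: euclidean_representation)
    also have "\<dots> = z \<bullet> (\<Sum>b\<in>Basis. h' b *\<^sub>R b)"
      by (simp add: sum scaleR inner_sum_right mult.commute)
    finally show ?thesis .
  qed
  then have "h' = (\<lambda>z. z \<bullet> (\<Sum>b\<in>Basis. h' b *\<^sub>R b))" ..
  with h' have "GDERIV h x :> (\<Sum>b\<in>Basis. h' b *\<^sub>R b)"
    by (simp add: gderiv_def)
  then show ?thesis using gradient_eq by metis
qed

text \<open>Mean value inequality for \<open>h\<close> minus its linear part at \<open>x\<close>,
  whose gradient has norm at most \<open>L * norm (y - x)\<close> on the segment. This gives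
  \<open>L\<close> instead of the sharp \<open>L / 2\<close>; only the quadratic order matters
  below.\<close>

lemma lipschitz_gradient_first_order_bound:
  fixes h :: "'a::euclidean_space \<Rightarrow> real"
  assumes diff: "\<And>w. h differentiable (at w)" and lip: "L-lipschitz_on UNIV (gradient h)"
  shows "\<bar>h y - h x - (y - x) \<bullet> gradient h x\<bar> \<le> L * (norm (y - x))\<^sup>2"
proof -
  have L: "0 \<le> L" using lip by (rule lipschitz_on_nonneg)
  define k where "k z = h z - z \<bullet> gradient h x" for z
  have k': "(k has_derivative (\<lambda>v. v \<bullet> (gradient h z - gradient h x)))
      (at z within closed_segment x y)" for z
    unfolding k_def inner_diff_right
    by (intro has_derivative_diff has_derivative_inner_left has_derivative_ident
        has_derivative_at_withinI[OF GDERIV_gradient[OF diff, unfolded gderiv_def]])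
  have "norm (k y - k x) \<le> (L * norm (y - x)) * norm (y - x)"
  proof (rule differentiable_bound[OF _ k'])
    fix z assume z: "z \<in> closed_segment x y"
    have "norm (gradient h z - gradient h x) \<le> L * norm (z - x)"
      using lipschitz_onD[OF lip, of z x] by (simp add: dist_norm)
    also have "\<dots> \<le> L * norm (y - x)"
      using L z by (intro mult_left_mono) (auto dest: segment_bound(1))
    finally have "norm (v \<bullet> (gradient h z - gradient h x)) \<le> (L * norm (y - x)) * norm v" for v
      using Cauchy_Schwarz_ineq2[of v "gradient h z - gradient h x"]
      by (smt (verit) mult.commute mult_right_mono norm_ge_zero real_norm_def)
    then show "onorm (\<lambda>v. v \<bullet> (gradient h z - gradient h x)) \<le> L * norm (y - x)"
      by (rule onorm_le)
  qed auto
  then show ?thesis by (simp add: k_def power2_eq_square inner_diff_left algebra_simps)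
qed

text \<open>Measurability of \<open>gradient (f \<zeta>) w\<close> in \<open>\<zeta>\<close> is not
  automatic, since the gradient is unspecified where \<open>f \<zeta>\<close> is not differentiable.
  Coordinatewise limits of difference quotients along \<open>1 / (n + 1)\<close> are measurable and
  agree with it almost everywhere.\<close>

lemma measurable_gradient_version:
  fixes f :: "'w \<Rightarrow> 'a::euclidean_space \<Rightarrow> real"
  assumes meas[measurable]: "\<And>w. (\<lambda>\<zeta>. f \<zeta> w) \<in> borel_measurable D"
    and diff: "AE \<zeta> in D. f \<zeta> differentiable (at w)"
  obtains G where "G \<in> borel_measurable D" "AE \<zeta> in D. gradient (f \<zeta>) w = G \<zeta>"
proof
  define q where "q b n \<zeta> = (f \<zeta> (w + inverse (real (Suc n)) *\<^sub>R b) - f \<zeta> w) / inverse (real (Suc n))"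
    for b n \<zeta>
  define G where "G \<zeta> = (\<Sum>b\<in>Basis. lim (\<lambda>n. q b n \<zeta>) *\<^sub>R b)" for \<zeta>
  show "G \<in> borel_measurable D"
    unfolding G_def q_def by measurable
  show "AE \<zeta> in D. gradient (f \<zeta>) w = G \<zeta>"
    using diff
  proof eventually_elim
    case (elim \<zeta>)
    have lim_q: "lim (\<lambda>n. q b n \<zeta>) = gradient (f \<zeta>) w \<bullet> b" for b
    proof -
      have "((\<lambda>t. f \<zeta> (w + t *\<^sub>R b)) has_derivative (\<lambda>t. (t *\<^sub>R b) \<bullet> gradient (f \<zeta>) w)) (at 0)"
      proof (rule has_derivative_compose[where f = "\<lambda>t. w + t *\<^sub>R b" and g = "f \<zeta>"])
        show "((\<lambda>t. w + t *\<^sub>R b) has_derivative (\<lambda>t. t *\<^sub>R b)) (at 0)"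
          by (auto intro!: derivative_eq_intros)
        show "(f \<zeta> has_derivative (\<lambda>v. v \<bullet> gradient (f \<zeta>) w)) (at (w + 0 *\<^sub>R b))"
          using GDERIV_gradient[OF elim] by (simp add: gderiv_def)
      qed
      then have "((\<lambda>t. f \<zeta> (w + t *\<^sub>R b)) has_field_derivative (gradient (f \<zeta>) w \<bullet> b)) (at 0)"
        by (simp add: has_field_derivative_def inner_commute mult_commute_abs)
      then have "(\<lambda>t. (f \<zeta> (w + t *\<^sub>R b) - f \<zeta> w) / t) \<midarrow>0\<rightarrow> gradient (f \<zeta>) w \<bullet> b"
        by (simp add: DERIV_def)
      moreover have "filterlim (\<lambda>n. inverse (real (Suc n))) (at 0) sequentially"
        by (simp add: filterlim_at LIMSEQ_inverse_real_of_nat del: of_nat_Suc)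
      ultimately have "(\<lambda>n. q b n \<zeta>) \<longlonglongrightarrow> gradient (f \<zeta>) w \<bullet> b"
        unfolding q_def by (rule filterlim_compose)
      then show ?thesis by (rule limI)
    qed
    show ?case
      unfolding G_def lim_q by (simp add: euclidean_representation)
  qed
qed

lemma norm_add_sq_le:
  fixes x y :: "'a::real_inner"
  shows "(norm (x + y))\<^sup>2 \<le> 2 * (norm x)\<^sup>2 + 2 * (norm y)\<^sup>2"
proof -
  have "(norm (x + y))\<^sup>2 + (norm (x - y))\<^sup>2 = 2 * (norm x)\<^sup>2 + 2 * (norm y)\<^sup>2"
    by (simp add: power2_norm_eq_inner algebra_simps)
  then show ?thesis using zero_le_power2[of "norm (x - y)"] by linarith
qed

lemma abs_inner_le_sum_sq:
  fixes x y :: "'a::real_inner"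
  shows "\<bar>x \<bullet> y\<bar> \<le> (norm x)\<^sup>2 + (norm y)\<^sup>2"
proof -
  have "2 * (norm x * norm y) \<le> (norm x)\<^sup>2 + (norm y)\<^sup>2"
    using zero_le_power2[of "norm x - norm y"] by (simp add: power2_diff)
  moreover have "0 \<le> norm x * norm y" by simp
  ultimately show ?thesis using Cauchy_Schwarz_ineq2[of x y] by linarith
qed

text \<open>Carries a finite second moment from the gradients at \<open>W0\<close> to those at
  \<open>Wstar\<close>, and from there to the centered gradients.\<close>

lemma square_integrable_bounded_diff:
  fixes G H :: "'w \<Rightarrow> 'a::euclidean_space"
  assumes "finite_measure D"
    and [measurable]: "G \<in> borel_measurable D"
    and int: "integrable D (\<lambda>\<zeta>. (norm (H \<zeta>))\<^sup>2)"
    and diff: "AE \<zeta> in D. norm (G \<zeta> - H \<zeta>) \<le> K"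
  shows "integrable D (\<lambda>\<zeta>. (norm (G \<zeta>))\<^sup>2)"
proof (rule Bochner_Integration.integrable_bound)
  interpret finite_measure D by fact
  show "integrable D (\<lambda>\<zeta>. 2 * (norm (H \<zeta>))\<^sup>2 + 2 * K\<^sup>2)"
    using int by simp
  show "AE \<zeta> in D. norm ((norm (G \<zeta>))\<^sup>2) \<le> norm (2 * (norm (H \<zeta>))\<^sup>2 + 2 * K\<^sup>2)"
    using diff
  proof eventually_elim
    case (elim \<zeta>)
    then have "(norm (G \<zeta> - H \<zeta>))\<^sup>2 \<le> K\<^sup>2" by (intro power_mono) auto
    then show ?case using norm_add_sq_le[of "H \<zeta>" "G \<zeta> - H \<zeta>"] by simp
  qed
qed simp

lemma square_integrable_nn_integral:
  fixes G :: "'w \<Rightarrow> 'a::euclidean_space"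
  assumes [measurable]: "G \<in> borel_measurable D"
    and "(\<integral>\<^sup>+\<zeta>. ennreal ((norm (G \<zeta>))\<^sup>2) \<partial>D) \<le> ennreal C"
  shows "integrable D (\<lambda>\<zeta>. (norm (G \<zeta>))\<^sup>2)"
  using le_less_trans[OF assms(2) ennreal_less_top]
  by (intro integrableI_bounded) simp_all

lemma square_integrable_imp_integrable_vector:
  fixes G :: "'w \<Rightarrow> 'a::euclidean_space"
  assumes "finite_measure D" and [measurable]: "G \<in> borel_measurable D"
    and int: "integrable D (\<lambda>\<zeta>. (norm (G \<zeta>))\<^sup>2)"
  shows "integrable D G"
proof (rule Bochner_Integration.integrable_bound)
  interpret finite_measure D by fact
  show "integrable D (\<lambda>\<zeta>. norm (G \<zeta>))"
    using int by (rule square_integrable_imp_integrable[rotated]) simp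
qed simp_all

text \<open>Differentiation under the integral: the first-order error of almost every
  \<open>f \<zeta>\<close> is at most \<open>L * (norm (y - w))\<^sup>2\<close>, with
  \<open>L\<close> independent of \<open>\<zeta>\<close>, so the bound survives integration.\<close>

lemma GDERIV_expected_loss:
  fixes f :: "'w \<Rightarrow> 'a::euclidean_space \<Rightarrow> real"
  assumes "prob_space D"
    and f_int: "\<And>w. integrable D (\<lambda>\<zeta>. f \<zeta> w)"
    and smooth: "AE \<zeta> in D. (\<forall>w. f \<zeta> differentiable (at w)) \<and> L-lipschitz_on UNIV (gradient (f \<zeta>))"
    and G_int: "integrable D G"
    and G_eq: "AE \<zeta> in D. gradient (f \<zeta>) w = G \<zeta>"
  shows "GDERIV (expected_loss D f) w :> (\<integral>\<zeta>. G \<zeta> \<partial>D)"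
proof -
  interpret prob_space D by fact
  let ?g = "\<integral>\<zeta>. G \<zeta> \<partial>D"
  have bound: "\<bar>expected_loss D f y - expected_loss D f w - (y - w) \<bullet> ?g\<bar> \<le> L * (norm (y - w))\<^sup>2" for y
  proof -
    have "\<bar>\<integral>\<zeta>. (f \<zeta> y - f \<zeta> w - (y - w) \<bullet> G \<zeta>) \<partial>D\<bar>
        \<le> (\<integral>\<zeta>. \<bar>f \<zeta> y - f \<zeta> w - (y - w) \<bullet> G \<zeta>\<bar> \<partial>D)"
      by (rule integral_abs_bound)
    also have "\<dots> \<le> (\<integral>\<zeta>. L * (norm (y - w))\<^sup>2 \<partial>D)"
    proof (rule integral_mono_AE)
      show "AE \<zeta> in D. \<bar>f \<zeta> y - f \<zeta> w - (y - w) \<bullet> G \<zeta>\<bar> \<le> L * (norm (y - w))\<^sup>2"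
        using smooth G_eq
        by eventually_elim (use lipschitz_gradient_first_order_bound in metis)
    qed (use f_int G_int in auto)
    finally show ?thesis
      using f_int G_int by (simp add: expected_loss_def prob_space)
  qed
  have "((\<lambda>y. expected_loss D f y) has_derivative (\<lambda>v. v \<bullet> ?g)) (at w)"
    unfolding has_derivative_within_alt
  proof (intro conjI allI impI)
    show "bounded_linear (\<lambda>v. v \<bullet> ?g)" by (rule bounded_linear_inner_left)
    fix e :: real assume e: "0 < e"
    \<comment> \<open>Chosen so that \<open>L * d \<le> e\<close>; the absolute value and the added
      1 keep the denominator positive.\<close>
    define d where "d = e / (\<bar>L\<bar> + 1)"
    have "0 < d" using e by (simp add: d_def)
    moreover have "norm (expected_loss D f y - expected_loss D f w - (y - w) \<bullet> ?g) \<le> e * norm (y - w)"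
      if "norm (y - w) < d" for y
    proof -
      have "L * norm (y - w) \<le> (\<bar>L\<bar> + 1) * d"
        using that by (intro mult_mono) auto
      also have "\<dots> = e" by (simp add: d_def)
      finally have "L * norm (y - w) * norm (y - w) \<le> e * norm (y - w)"
        by (rule mult_right_mono) simp
      then show ?thesis using bound[of y] by (simp add: power2_eq_square mult.assoc)
    qed
    ultimately show "\<exists>d>0. \<forall>y\<in>UNIV. norm (y - w) < d \<longrightarrow>
        norm (expected_loss D f y - expected_loss D f w - (y - w) \<bullet> ?g) \<le> e * norm (y - w)"
      by blast
  qed
  then show ?thesis by (simp add: gderiv_def)
qed

section \<open>Averages of pairwise orthogonal noise\<close>

text \<open>In coordinates the inner product is a sum of products of independent real variables.
  Each product is integrable by independence, and its mean factors through a coordinate mean of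
  \<open>Y\<close>, which is 0.\<close>

lemma (in prob_space) indep_centered_inner_integral:
  fixes X Y :: "'a \<Rightarrow> 'b::euclidean_space"
  assumes indep: "indep_var borel X borel Y"
    and int: "integrable M X" "integrable M Y" and mean: "(\<integral>\<omega>. Y \<omega> \<partial>M) = 0"
  shows "(\<integral>\<omega>. X \<omega> \<bullet> Y \<omega> \<partial>M) = 0"
proof -
  have comp: "indep_var borel (\<lambda>\<omega>. X \<omega> \<bullet> b) borel (\<lambda>\<omega>. Y \<omega> \<bullet> b)" for b
    using indep_var_compose[OF indep, of "\<lambda>x. x \<bullet> b" borel "\<lambda>x. x \<bullet> b" borel]
    by (simp add: comp_def)
  have "(\<integral>\<omega>. (X \<omega> \<bullet> b) * (Y \<omega> \<bullet> b) \<partial>M) = 0" for b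
    using indep_var_lebesgue_integral[OF comp[of b]] int mean by simp
  moreover have "integrable M (\<lambda>\<omega>. (X \<omega> \<bullet> b) * (Y \<omega> \<bullet> b))" for b
    by (rule indep_var_integrable[OF comp]) (use int in simp_all)
  ultimately show ?thesis
    by (subst euclidean_inner) (simp add: Bochner_Integration.integral_sum)
qed

text \<open>With the ratios of increment to \<alpha> as weights, this is the sum of the
  \<open>X\<close> weighted by the increments and divided by \<alpha>. The recursive form is the one
  the averaging lemmas accept.\<close>

primrec weighted_average :: "(nat \<Rightarrow> real) \<Rightarrow> (nat \<Rightarrow> 'm \<Rightarrow> 'a::real_vector) \<Rightarrow> nat \<Rightarrow> 'm \<Rightarrow> 'a" where
  "weighted_average c X 0 \<omega> = 0"
| "weighted_average c X (Suc n) \<omega> = (1 - c n) *\<^sub>R weighted_average c X n \<omega> + c n *\<^sub>R X n \<omega>"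

text \<open>Orthogonality removes the cross term, so the mean squares \<open>a\<close> satisfy
  \<open>a (Suc n) \<le> (1 - c n) * a n + c n * (c n * S)\<close>. This is a scalar averaging
  recursion whose driving term \<open>c n * S\<close> tends to 0.\<close>

lemma weighted_average_orthogonal_L2:
  fixes X :: "nat \<Rightarrow> 'm \<Rightarrow> 'a::euclidean_space"
  assumes meas[measurable]: "\<And>n. X n \<in> borel_measurable M"
    and sq_int: "\<And>n. integrable M (\<lambda>\<omega>. (norm (X n \<omega>))\<^sup>2)"
    and sq_bound: "\<And>n. (\<integral>\<omega>. (norm (X n \<omega>))\<^sup>2 \<partial>M) \<le> S"
    and orth: "\<And>m n. m < n \<Longrightarrow> (\<integral>\<omega>. X m \<omega> \<bullet> X n \<omega> \<partial>M) = 0"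
    and c01: "\<And>n. 0 \<le> c n" "\<And>n. c n \<le> 1"
    and c_sum: "filterlim (\<lambda>n. \<Sum>k<n. c k) at_top sequentially"
    and c_lim: "c \<longlonglongrightarrow> 0"
  shows "\<And>n. integrable M (\<lambda>\<omega>. (norm (weighted_average c X n \<omega>))\<^sup>2)"
    and "(\<lambda>n. \<integral>\<omega>. (norm (weighted_average c X n \<omega>))\<^sup>2 \<partial>M) \<longlonglongrightarrow> 0"
proof -
  let ?m = "weighted_average c X"
  have m_meas[measurable]: "?m n \<in> borel_measurable M" for n
    by (induction n) simp_all
  have inner_int: "integrable M (\<lambda>\<omega>. U \<omega> \<bullet> X n \<omega>)"
    if [measurable]: "U \<in> borel_measurable M" and "integrable M (\<lambda>\<omega>. (norm (U \<omega>))\<^sup>2)" for U n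
  proof (rule Bochner_Integration.integrable_bound)
    show "integrable M (\<lambda>\<omega>. (norm (U \<omega>))\<^sup>2 + (norm (X n \<omega>))\<^sup>2)"
      using that sq_int by simp
  qed (use abs_inner_le_sum_sq in \<open>auto intro!: AE_I2\<close>)
  have expand: "(norm (?m (Suc n) \<omega>))\<^sup>2 = (1 - c n)\<^sup>2 * (norm (?m n \<omega>))\<^sup>2
      + 2 * (1 - c n) * c n * (?m n \<omega> \<bullet> X n \<omega>) + (c n)\<^sup>2 * (norm (X n \<omega>))\<^sup>2" for n \<omega>
    unfolding power2_norm_eq_inner weighted_average.simps
    by (simp add: inner_add_left inner_add_right inner_commute power2_eq_square algebra_simps)
  show m_int: "integrable M (\<lambda>\<omega>. (norm (?m n \<omega>))\<^sup>2)" for n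
  proof (induction n)
    case (Suc n)
    then show ?case
      unfolding expand using sq_int inner_int[OF m_meas Suc] by simp
  qed simp
  \<comment> \<open>The average with index \<open>m\<close> involves only \<open>X k\<close> with
    \<open>k < m\<close>, hence \<open>m = n\<close> is still allowed.\<close>
  have m_orth: "(\<integral>\<omega>. ?m m \<omega> \<bullet> X n \<omega> \<partial>M) = 0" if "m \<le> n" for m n
    using that
  proof (induction m)
    case (Suc m)
    then show ?case
      using inner_int[OF m_meas m_int, of m n] inner_int[OF meas sq_int, of m n] orth[of m n]
      by (simp add: inner_add_left)
  qed simp
  show "(\<lambda>n. \<integral>\<omega>. (norm (?m n \<omega>))\<^sup>2 \<partial>M) \<longlonglongrightarrow> 0"
  proof (rule averaging_tendsto_0[OF _ _ c01 c_sum])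
    fix n
    let ?a = "\<lambda>n. \<integral>\<omega>. (norm (?m n \<omega>))\<^sup>2 \<partial>M"
    show "0 \<le> ?a n" by simp
    have "?a (Suc n) = (1 - c n)\<^sup>2 * ?a n + (c n)\<^sup>2 * (\<integral>\<omega>. (norm (X n \<omega>))\<^sup>2 \<partial>M)"
      unfolding expand using m_int[of n] sq_int[of n] inner_int[OF m_meas m_int, of n n] m_orth[of n n]
      by simp
    \<comment> \<open>One factor \<open>1 - c n\<close> is given up to reach the form of the
      averaging recursion.\<close>
    also have "(1 - c n)\<^sup>2 * ?a n \<le> (1 - c n) * ?a n"
      using c01[of n] by (intro mult_right_mono) (simp_all add: power2_eq_square mult_left_le_one_le)
    also have "(c n)\<^sup>2 * (\<integral>\<omega>. (norm (X n \<omega>))\<^sup>2 \<partial>M) \<le> (c n)\<^sup>2 * S"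
      by (intro mult_left_mono sq_bound) simp
    finally show "?a (Suc n) \<le> (1 - c n) * ?a n + c n * (c n * S)"
      by (simp add: power2_eq_square mult.assoc)
  next
    show "(\<lambda>n. c n * S) \<longlonglongrightarrow> 0"
      using tendsto_mult[OF c_lim tendsto_const] by simp
  qed
qed

section \<open>Convergence of RMDA\<close>

lemma rmda_alpha_Suc:
  "rmda_alpha \<eta> (Suc n) = rmda_alpha \<eta> n + rmda_beta (Suc n) * \<eta> (Suc n)"
  by (simp add: rmda_alpha_def)

lemma rmda_alpha_nonneg:
  assumes "\<And>t. t \<ge> 1 \<Longrightarrow> \<eta> t > 0"
  shows "0 \<le> rmda_alpha \<eta> n"
  unfolding rmda_alpha_def using assms
  by (intro sum_nonneg) (auto simp: rmda_beta_def less_imp_le)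

lemma rmda_increment_pos:
  assumes "\<And>t. t \<ge> 1 \<Longrightarrow> \<eta> t > 0"
  shows "0 < rmda_beta (Suc n) * \<eta> (Suc n)"
  using assms[of "Suc n"] by (simp add: rmda_beta_def)

lemma rmda_alpha_pos:
  assumes "\<And>t. t \<ge> 1 \<Longrightarrow> \<eta> t > 0"
  shows "0 < rmda_alpha \<eta> (Suc n)"
  using rmda_alpha_nonneg[of \<eta>, OF assms] rmda_increment_pos[of \<eta>, OF assms]
  by (simp add: rmda_alpha_Suc add_nonneg_pos)

lemma rmda_step_ratio_bounds:
  assumes "\<And>t. t \<ge> 1 \<Longrightarrow> \<eta> t > 0"
  shows "0 \<le> rmda_beta (Suc n) * \<eta> (Suc n) / rmda_alpha \<eta> (Suc n)"
    and "rmda_beta (Suc n) * \<eta> (Suc n) / rmda_alpha \<eta> (Suc n) \<le> 1"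
  using rmda_increment_pos[of \<eta> n, OF assms] rmda_alpha_pos[of \<eta> n, OF assms]
    rmda_alpha_nonneg[of \<eta> n, OF assms]
  by (simp_all add: divide_le_eq_1) (simp add: rmda_alpha_Suc)

text \<open>The deterministic core, for one fixed path: chance enters only through the averaged
  noise \<open>m\<close>, assumed to vanish along \<open>r\<close>. After subtracting
  \<open>m\<close>, the normalized dual vector is an average of vectors tending to \<open>g\<close>,
  so it converges along the whole sequence; adding \<open>m\<close> back costs the passage to
  \<open>r\<close>.\<close>

lemma rmda_trajectory_regular_subgradient:
  fixes f :: "'w \<Rightarrow> 'a::euclidean_space \<Rightarrow> real" and \<psi> :: "'a \<Rightarrow> ereal"
    and \<eta> :: "nat \<Rightarrow> real"
  defines "\<gamma> \<equiv> \<lambda>n. rmda_beta (Suc n) * \<eta> (Suc n) / rmda_alpha \<eta> (Suc n)"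
  assumes traj: "rmda_trajectory f \<psi> W0 \<eta> c \<xi> V Wt W"
    and ninf: "\<And>y. \<psi> y \<noteq> -\<infinity>" and proper: "\<psi> z \<noteq> \<infinity>"
    and eta_pos: "\<And>t. t \<ge> 1 \<Longrightarrow> \<eta> t > 0"
    and c_range: "\<And>t. t \<ge> 1 \<Longrightarrow> c t \<in> {0..1}"
    and c_sum: "filterlim (\<lambda>n. \<Sum>k<n. c (Suc k)) at_top sequentially"
    and steps_sum: "filterlim (\<lambda>n. \<Sum>k<n. \<gamma> k) at_top sequentially"
    and beta_alpha: "(\<lambda>t. rmda_beta t / rmda_alpha \<eta> t) \<longlonglongrightarrow> 0"
    and lip: "\<And>n. L-lipschitz_on UNIV (gradient (f (\<xi> (Suc n))))"
    and noise_rec: "\<And>n. m (Suc n) = (1 - \<gamma> n) *\<^sub>R m n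
                        + \<gamma> n *\<^sub>R (gradient (f (\<xi> (Suc n))) Wstar - g)"
    and r: "strict_mono r" and noise_lim: "(\<lambda>n. m (r n)) \<longlonglongrightarrow> 0"
    and Wt_lim: "Wt \<longlonglongrightarrow> Wstar"
    and osc: "outer_semicontinuous_at (regular_subdifferential \<psi>) Wstar"
  shows "- g \<in> regular_subdifferential \<psi> Wstar"
proof -
  define a where "a = rmda_alpha \<eta>"
  define U where "U n = V n /\<^sub>R a n" for n
  have a_pos: "0 < a (Suc n)" for n
    unfolding a_def using eta_pos by (rule rmda_alpha_pos)
  have \<gamma>_eq: "\<gamma> n = rmda_beta (Suc n) * \<eta> (Suc n) / a (Suc n)" for n
    by (simp add: \<gamma>_def a_def)
  \<comment> \<open>This identity turns the normalization of \<open>V\<close> by \<alpha> into a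
    convex averaging recursion.\<close>
  have \<gamma>_compl: "1 - \<gamma> n = a n / a (Suc n)" for n
    using a_pos[of n] by (simp add: \<gamma>_eq field_simps) (simp add: a_def rmda_alpha_Suc)
  have \<gamma>01: "0 \<le> \<gamma> n" "\<gamma> n \<le> 1" for n
    unfolding \<gamma>_def using rmda_step_ratio_bounds[of \<eta> n] eta_pos by blast+
  have V_0: "V 0 = 0"
    and V_Suc: "V (Suc n) = V n + (rmda_beta (Suc n) * \<eta> (Suc n)) *\<^sub>R gradient (f (\<xi> (Suc n))) (W n)"
    and Wt_min: "is_arg_min (rmda_subproblem \<psi> W0 \<eta> (Suc n) (V (Suc n))) (\<lambda>_. True) (Wt (Suc n))"
    and W_Suc: "W (Suc n) = (1 - c (Suc n)) *\<^sub>R W n + c (Suc n) *\<^sub>R Wt (Suc n)" for n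
  proof -
    show "V 0 = 0" using traj by (simp add: rmda_trajectory_def)
    have step: "V t = V (t - 1) + (rmda_beta t * \<eta> t) *\<^sub>R gradient (f (\<xi> t)) (W (t - 1)) \<and>
            is_arg_min (rmda_subproblem \<psi> W0 \<eta> t (V t)) (\<lambda>_. True) (Wt t) \<and>
            W t = (1 - c t) *\<^sub>R W (t - 1) + c t *\<^sub>R Wt t" if "1 \<le> t" for t
      using traj that unfolding rmda_trajectory_def by blast
    show "V (Suc n) = V n + (rmda_beta (Suc n) * \<eta> (Suc n)) *\<^sub>R gradient (f (\<xi> (Suc n))) (W n)"
      "is_arg_min (rmda_subproblem \<psi> W0 \<eta> (Suc n) (V (Suc n))) (\<lambda>_. True) (Wt (Suc n))"
      "W (Suc n) = (1 - c (Suc n)) *\<^sub>R W n + c (Suc n) *\<^sub>R Wt (Suc n)"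
      using step[of "Suc n"] unfolding diff_Suc_1 by auto
  qed
  have W_lim: "W \<longlonglongrightarrow> Wstar"
  proof (rule averaging_vector_tendsto[where c = "\<lambda>n. c (Suc n)" and y = "\<lambda>n. Wt (Suc n)", OF W_Suc])
    show "(\<lambda>n. Wt (Suc n)) \<longlonglongrightarrow> Wstar" using Wt_lim by (rule LIMSEQ_Suc)
  qed (use c_range c_sum in auto)
  have U_Suc: "U (Suc n) = (1 - \<gamma> n) *\<^sub>R U n + \<gamma> n *\<^sub>R gradient (f (\<xi> (Suc n))) (W n)" for n
  proof -
    \<comment> \<open>The case \<open>n = 0\<close> is separate: there \<open>a 0 = 0\<close>, and
      the equation holds because \<open>V 0 = 0\<close>.\<close>
    have "V n = a n *\<^sub>R U n"
    proof (cases n)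
      case (Suc k)
      then show ?thesis using a_pos[of k] by (simp add: U_def)
    qed (simp add: V_0 U_def)
    then show ?thesis
      unfolding U_def[of "Suc n"] V_Suc \<gamma>_compl
      by (simp add: \<gamma>_eq scaleR_add_right divide_inverse mult.commute)
  qed
  have "(\<lambda>n. U n - m n) \<longlonglongrightarrow> g"
  proof (rule averaging_vector_tendsto[OF _ \<gamma>01 steps_sum])
    show "U (Suc n) - m (Suc n) = (1 - \<gamma> n) *\<^sub>R (U n - m n)
        + \<gamma> n *\<^sub>R (g + (gradient (f (\<xi> (Suc n))) (W n) - gradient (f (\<xi> (Suc n))) Wstar))" for n
      by (simp add: U_Suc noise_rec algebra_simps)
    have "(\<lambda>n. gradient (f (\<xi> (Suc n))) (W n) - gradient (f (\<xi> (Suc n))) Wstar) \<longlonglongrightarrow> 0"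
    proof (rule Lim_null_comparison)
      show "\<forall>\<^sub>F n in sequentially. norm (gradient (f (\<xi> (Suc n))) (W n) - gradient (f (\<xi> (Suc n))) Wstar)
          \<le> L * norm (W n - Wstar)"
        using lipschitz_onD[OF lip] by (simp add: dist_norm)
      show "(\<lambda>n. L * norm (W n - Wstar)) \<longlonglongrightarrow> 0"
        using W_lim by (intro tendsto_mult_right_zero) (simp add: tendsto_norm_zero_iff LIM_zero_iff)
    qed
    from tendsto_add[OF tendsto_const this]
    show "(\<lambda>n. g + (gradient (f (\<xi> (Suc n))) (W n) - gradient (f (\<xi> (Suc n))) Wstar)) \<longlonglongrightarrow> g"
      by simp
  qed
  from tendsto_add[OF LIMSEQ_subseq_LIMSEQ[OF this r] noise_lim]
  have U_lim: "(\<lambda>n. U (r n)) \<longlonglongrightarrow> g"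
    by (simp add: comp_def)
  define p where "p n = - U n - (rmda_beta n / a n) *\<^sub>R (Wt n - W0)" for n
  \<comment> \<open>The shift to \<open>Suc k\<close> keeps the round at least 1; \<open>r 0\<close>
    may be 0, and round 0 has no subproblem.\<close>
  have p_sub: "p (r (Suc k)) \<in> regular_subdifferential \<psi> (Wt (r (Suc k)))" for k
  proof -
    have "r k < r (Suc k)" using r by (simp add: strict_mono_Suc_iff)
    then obtain j where j: "r (Suc k) = Suc j" by (cases "r (Suc k)") auto
    show ?thesis
      unfolding j p_def U_def a_def
      by (rule rmda_subproblem_subgradient[OF Wt_min a_pos[unfolded a_def] ninf proper])
  qed
  have "(\<lambda>n. - U (r n) - (rmda_beta (r n) / a (r n)) *\<^sub>R (Wt (r n) - W0)) \<longlonglongrightarrow> - g - 0 *\<^sub>R (Wstar - W0)"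
    using LIMSEQ_subseq_LIMSEQ[OF beta_alpha r] LIMSEQ_subseq_LIMSEQ[OF Wt_lim r]
    by (intro tendsto_intros U_lim) (simp_all add: comp_def a_def)
  then have "(\<lambda>k. p (r (Suc k))) \<longlonglongrightarrow> - g"
    using LIMSEQ_Suc by (fastforce simp: p_def)
  moreover have "(\<lambda>k. Wt (r (Suc k))) \<longlonglongrightarrow> Wstar"
    using LIMSEQ_Suc[OF LIMSEQ_subseq_LIMSEQ[OF Wt_lim r]] by (simp add: comp_def)
  ultimately show ?thesis
    using osc[unfolded outer_semicontinuous_at_def, rule_format,
        of "\<lambda>k. Wt (r (Suc k))" "\<lambda>k. p (r (Suc k))"] p_sub by simp
qed

section \<open>Independence of the samples\<close>

lemma (in prob_space) indep_var_of_indep_set: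
  assumes indep: "indep_set (sets N1) (sets N2)"
    and space: "space N1 = space M" "space N2 = space M"
    and X: "X \<in> N1 \<rightarrow>\<^sub>M S" and Y: "Y \<in> N2 \<rightarrow>\<^sub>M T"
  shows "indep_var S X T Y"
proof -
  have N: "sets N1 \<subseteq> events" "sets N2 \<subseteq> events"
    and mult: "\<And>a b. a \<in> sets N1 \<Longrightarrow> b \<in> sets N2 \<Longrightarrow> prob (a \<inter> b) = prob a * prob b"
    using indep by (auto simp: indep_sets2_eq)
  \<comment> \<open>Measurability with respect to \<open>N1\<close> and \<open>N2\<close> places the
    generated sigma-algebras inside independent ones.\<close>
  have sub: "sigma_sets (space M) {X -` A \<inter> space M |A. A \<in> sets S} \<subseteq> sets N1"
      "sigma_sets (space M) {Y -` A \<inter> space M |A. A \<in> sets T} \<subseteq> sets N2"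
    using sets.sigma_sets_subset[of "{X -` A \<inter> space M |A. A \<in> sets S}" N1]
      sets.sigma_sets_subset[of "{Y -` A \<inter> space M |A. A \<in> sets T}" N2]
      measurable_sets[OF X] measurable_sets[OF Y] space by auto
  have "random_variable S X" "random_variable T Y"
    using X Y N space by (auto simp: measurable_def)
  then show ?thesis
    unfolding indep_var_eq indep_sets2_eq using sub N mult by blast
qed

text \<open>For \<open>s < t\<close> the sample \<open>\<xi> s\<close> is a coordinate of the past
  of round \<open>t\<close>, of which \<open>\<xi> t\<close> is independent. Pairwise independence
  is what orthogonality of the noise requires.\<close>

lemma rmda_process_samples_indep:
  assumes rmda: "rmda_process M D f \<psi> W0 \<eta> c \<xi> V Wt W" and st: "1 \<le> s" "s < t"
  shows "prob_space.indep_var M D (\<xi> s) D (\<xi> t)"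
proof -
  interpret prob_space M using rmda by (simp add: rmda_process_def)
  have \<xi>: "\<xi> u \<in> M \<rightarrow>\<^sub>M D" if "1 \<le> u" for u
    using rmda that by (simp add: rmda_process_def)
  define h where "h = (\<lambda>\<omega>. \<lambda>u\<in>{1..<t}. (\<xi> u \<omega>, Wt u \<omega>))"
  let ?P = "\<Pi>\<^sub>M u\<in>{1..<t}. D \<Otimes>\<^sub>M (borel :: 'c measure)"
  have past: "rmda_past M D \<xi> Wt t = vimage_algebra (space M) h ?P"
    by (simp add: rmda_past_def h_def)
  have "h \<in> space M \<rightarrow> space ?P"
    using measurable_space[OF \<xi>] by (auto simp: h_def space_PiM space_pair_measure)
  then have h: "h \<in> rmda_past M D \<xi> Wt t \<rightarrow>\<^sub>M ?P"
    unfolding past by (rule measurable_vimage_algebra1)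
  have "(\<lambda>x. fst (x s)) \<in> ?P \<rightarrow>\<^sub>M D"
    by (rule measurable_compose[OF measurable_component_singleton[where M = "\<lambda>_. D \<Otimes>\<^sub>M borel"]
          measurable_fst]) (use st in auto)
  from measurable_comp[OF h this] have s_past: "\<xi> s \<in> rmda_past M D \<xi> Wt t \<rightarrow>\<^sub>M D"
    using st by (simp add: comp_def h_def)
  have "indep_set (sets (vimage_algebra (space M) (\<xi> t) D)) (sets (rmda_past M D \<xi> Wt t))"
    using rmda st by (simp add: rmda_process_def)
  then have "indep_set (sets (rmda_past M D \<xi> Wt t)) (sets (vimage_algebra (space M) (\<xi> t) D))"
    by (simp add: indep_sets2_eq) (metis Int_commute mult.commute)
  then show ?thesis
  proof (rule indep_var_of_indep_set[OF _ _ _ s_past])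
    show "\<xi> t \<in> vimage_algebra (space M) (\<xi> t) D \<rightarrow>\<^sub>M D"
      using measurable_space[OF \<xi>[of t]] st by (intro measurable_vimage_algebra1) auto
  qed (simp_all add: past)
qed

theorem theorem1:
  fixes D :: "'w measure" and M :: "'m measure"
    and f :: "'w \<Rightarrow> 'a::euclidean_space \<Rightarrow> real" and \<psi> :: "'a \<Rightarrow> ereal"
    and \<eta> c :: "nat \<Rightarrow> real" and L C :: real
    and \<xi> :: "nat \<Rightarrow> 'm \<Rightarrow> 'w" and V Wt W :: "nat \<Rightarrow> 'm \<Rightarrow> 'a"
    and W0 Wstar :: 'a
  assumes problem: "stochastic_problem D f \<psi>"
    and eta_pos: "\<And>t. t \<ge> 1 \<Longrightarrow> \<eta> t > 0"
    and c_range: "\<And>t. t \<ge> 1 \<Longrightarrow> c t \<in> {0..1}"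
    and rmda: "rmda_process M D f \<psi> W0 \<eta> c \<xi> V Wt W"
    and c_sum: "filterlim (\<lambda>n. \<Sum>t=1..n. c t) at_top sequentially"
    and smooth: "AE \<zeta> in D. (\<forall>w. f \<zeta> differentiable (at w)) \<and>
                   L-lipschitz_on UNIV (gradient (f \<zeta>))"
    and C_nonneg: "C \<ge> 0"
    and second_moment: "\<And>t. t \<ge> 1 \<Longrightarrow>
          AE \<omega> in M. (\<integral>\<^sup>+\<zeta>. ennreal ((norm (gradient (f \<zeta>) (W (t - 1) \<omega>)))\<^sup>2) \<partial>D) \<le> ennreal C"
    and steps_sum: "filterlim (\<lambda>n. \<Sum>t=1..n. rmda_beta t * \<eta> t / rmda_alpha \<eta> t)
                      at_top sequentially"
    and steps_sq_sum: "summable (\<lambda>t. (rmda_beta (Suc t) * \<eta> (Suc t) / rmda_alpha \<eta> (Suc t))\<^sup>2)"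
    and increments: "AE \<omega> in M.
          (\<lambda>t. norm (W (Suc t) \<omega> - W t \<omega>) / (rmda_beta t * \<eta> t / rmda_alpha \<eta> t)) \<longlonglongrightarrow> 0"
    and stationary_nonempty: "stationary_points D f \<psi> \<noteq> {}"
    and beta_alpha: "(\<lambda>t. rmda_beta t / rmda_alpha \<eta> t) \<longlonglongrightarrow> 0"
    and osc: "outer_semicontinuous_at (regular_subdifferential \<psi>) Wstar"
    and event_pos: "\<P>(\<omega> in M. (\<lambda>t. Wt t \<omega>) \<longlonglongrightarrow> Wstar) \<noteq> 0"
  shows "\<P>(\<omega> in M. Wstar \<in> stationary_points D f \<psi> \<bar> (\<lambda>t. Wt t \<omega>) \<longlonglongrightarrow> Wstar) = 1
         \<and> Wstar \<in> stationary_points D f \<psi>"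
proof -
  interpret D: prob_space D using problem by (simp add: stochastic_problem_def)
  interpret M: prob_space M using rmda by (simp add: rmda_process_def)
  have f_int: "\<And>w. integrable D (\<lambda>\<zeta>. f \<zeta> w)" and ninf: "\<And>w. \<psi> w \<noteq> -\<infinity>"
    using problem by (auto simp: stochastic_problem_def)
  \<comment> \<open>The objective is finite at a stationary point, which supplies a point where
    \<psi> is finite.\<close>
  obtain z where "z \<in> stationary_points D f \<psi>" using stationary_nonempty by blast
  then have proper: "\<psi> z \<noteq> \<infinity>"
    by (auto simp: stationary_points_def regular_subdifferential_def objective_def)
  have \<xi>[measurable]: "\<xi> (Suc n) \<in> M \<rightarrow>\<^sub>M D" and \<xi>_distr: "distr M D (\<xi> (Suc n)) = D" for n
    using rmda by (simp_all add: rmda_process_def)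
  have traj: "AE \<omega> in M. rmda_trajectory f \<psi> W0 \<eta> c
        (\<lambda>t. \<xi> t \<omega>) (\<lambda>t. V t \<omega>) (\<lambda>t. Wt t \<omega>) (\<lambda>t. W t \<omega>)"
    using rmda by (simp add: rmda_process_def)
  \<comment> \<open>Each sample has law \<open>D\<close>, and countably many null sets are discarded
    together.\<close>
  have AE_sample: "AE \<omega> in M. \<forall>n. P (\<xi> (Suc n) \<omega>)" if "AE \<zeta> in D. P \<zeta>" for P
    unfolding AE_all_countable
  proof
    fix n
    show "AE \<omega> in M. P (\<xi> (Suc n) \<omega>)"
      by (rule AE_distrD[OF \<xi>]) (unfold \<xi>_distr, rule that)
  qed

  \<comment> \<open>Gradient of the expected loss at the limit point\<close>
  have diff: "AE \<zeta> in D. f \<zeta> differentiable (at w)" for w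
    using smooth by eventually_elim simp
  obtain G where G[measurable]: "G \<in> borel_measurable D"
    and G_eq: "AE \<zeta> in D. gradient (f \<zeta>) Wstar = G \<zeta>"
    using measurable_gradient_version[of f D, OF _ diff] f_int by blast
  obtain G0 where G0[measurable]: "G0 \<in> borel_measurable D"
    and G0_eq: "AE \<zeta> in D. gradient (f \<zeta>) W0 = G0 \<zeta>"
    using measurable_gradient_version[of f D, OF _ diff] f_int by blast
  \<comment> \<open>In round 1 the iterate is the deterministic \<open>W0\<close>, so the moment
    bound no longer depends on \<open>\<omega>\<close> and holds outright. The Lipschitz condition
    then transports square integrability to \<open>Wstar\<close>.\<close>
  have "AE \<omega> in M. (\<integral>\<^sup>+\<zeta>. ennreal ((norm (gradient (f \<zeta>) W0))\<^sup>2) \<partial>D) \<le> ennreal C"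
    using second_moment[OF order_refl] traj
    by eventually_elim (simp add: rmda_trajectory_def)
  then have "(\<integral>\<^sup>+\<zeta>. ennreal ((norm (gradient (f \<zeta>) W0))\<^sup>2) \<partial>D) \<le> ennreal C"
    by simp
  also have "(\<integral>\<^sup>+\<zeta>. ennreal ((norm (gradient (f \<zeta>) W0))\<^sup>2) \<partial>D) = (\<integral>\<^sup>+\<zeta>. ennreal ((norm (G0 \<zeta>))\<^sup>2) \<partial>D)"
    using G0_eq by (intro nn_integral_cong_AE) auto
  finally have G0_sq: "integrable D (\<lambda>\<zeta>. (norm (G0 \<zeta>))\<^sup>2)"
    by (rule square_integrable_nn_integral[OF G0])
  have "AE \<zeta> in D. norm (G \<zeta> - G0 \<zeta>) \<le> L * norm (Wstar - W0)"
    using smooth G_eq G0_eq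
  proof eventually_elim
    case (elim \<zeta>)
    then show ?case
      using lipschitz_onD[of L UNIV "gradient (f \<zeta>)" Wstar W0] by (simp add: dist_norm)
  qed
  then have G_sq: "integrable D (\<lambda>\<zeta>. (norm (G \<zeta>))\<^sup>2)"
    by (rule square_integrable_bounded_diff[OF D.finite_measure_axioms G G0_sq])
  then have G_int: "integrable D G"
    by (rule square_integrable_imp_integrable_vector[OF D.finite_measure_axioms G])
  define g where "g = (\<integral>\<zeta>. G \<zeta> \<partial>D)"
  have gderiv: "GDERIV (expected_loss D f) Wstar :> g"
    unfolding g_def by (rule GDERIV_expected_loss[OF D.prob_space_axioms f_int smooth G_int G_eq])

  \<comment> \<open>The centered noise at the limit point\<close>
  define Y where "Y \<zeta> = G \<zeta> - g" for \<zeta>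
  have Y[measurable]: "Y \<in> borel_measurable D" unfolding Y_def by simp
  have Y_sq: "integrable D (\<lambda>\<zeta>. (norm (Y \<zeta>))\<^sup>2)"
    by (rule square_integrable_bounded_diff[OF D.finite_measure_axioms Y G_sq, of "norm g"])
      (simp add: Y_def)
  have Y_int: "integrable D Y" and Y_mean: "(\<integral>\<zeta>. Y \<zeta> \<partial>D) = 0"
    unfolding Y_def using G_int by (simp_all add: g_def D.prob_space)
  define X where "X n \<omega> = Y (\<xi> (Suc n) \<omega>)" for n \<omega>
  have X_meas: "X n \<in> borel_measurable M" for n unfolding X_def by simp
  have X_int: "integrable M (X n)" and X_mean: "(\<integral>\<omega>. X n \<omega> \<partial>M) = 0"
    and X_sq: "integrable M (\<lambda>\<omega>. (norm (X n \<omega>))\<^sup>2)"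
    and X_var: "(\<integral>\<omega>. (norm (X n \<omega>))\<^sup>2 \<partial>M) = (\<integral>\<zeta>. (norm (Y \<zeta>))\<^sup>2 \<partial>D)" for n
  proof -
    show "integrable M (X n)"
      unfolding X_def using integrable_distr[OF \<xi>, of n Y] Y_int \<xi>_distr[of n] by simp
    show "(\<integral>\<omega>. X n \<omega> \<partial>M) = 0"
      unfolding X_def using integral_distr[OF \<xi> Y, of n] Y_mean \<xi>_distr[of n] by simp
    show "integrable M (\<lambda>\<omega>. (norm (X n \<omega>))\<^sup>2)"
      unfolding X_def using integrable_distr[OF \<xi>, of n "\<lambda>\<zeta>. (norm (Y \<zeta>))\<^sup>2"] Y_sq \<xi>_distr[of n]
      by simp
    show "(\<integral>\<omega>. (norm (X n \<omega>))\<^sup>2 \<partial>M) = (\<integral>\<zeta>. (norm (Y \<zeta>))\<^sup>2 \<partial>D)"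
      unfolding X_def using integral_distr[OF \<xi>, of "\<lambda>\<zeta>. (norm (Y \<zeta>))\<^sup>2" n] \<xi>_distr[of n]
      by simp
  qed
  have X_orth: "(\<integral>\<omega>. X m \<omega> \<bullet> X n \<omega> \<partial>M) = 0" if "m < n" for m n
  proof (rule M.indep_centered_inner_integral[OF _ X_int X_int X_mean])
    have "M.indep_var D (\<xi> (Suc m)) D (\<xi> (Suc n))"
      using that by (intro rmda_process_samples_indep[OF rmda]) auto
    from M.indep_var_compose[OF this Y Y] show "M.indep_var borel (X m) borel (X n)"
      by (simp add: X_def[abs_def] comp_def)
  qed
  define \<gamma> where "\<gamma> n = rmda_beta (Suc n) * \<eta> (Suc n) / rmda_alpha \<eta> (Suc n)" for n
  have \<gamma>01: "0 \<le> \<gamma> n" "\<gamma> n \<le> 1" for n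
    unfolding \<gamma>_def using rmda_step_ratio_bounds[of \<eta> n] eta_pos by blast+
  have \<gamma>_sum: "filterlim (\<lambda>n. \<Sum>k<n. \<gamma> k) at_top sequentially"
    using steps_sum unfolding \<gamma>_def by (subst sum_bounds_lt_plus1)
  have c_sum': "filterlim (\<lambda>n. \<Sum>k<n. c (Suc k)) at_top sequentially"
    using c_sum by (subst sum_bounds_lt_plus1)
  have \<gamma>_lim: "\<gamma> \<longlonglongrightarrow> 0"
    using summable_LIMSEQ_zero[OF steps_sq_sum] by (simp add: \<gamma>_def[abs_def] power_tendsto_0_iff)
  \<comment> \<open>The bound \<open>S\<close> is the common variance, the second moment of
    \<open>Y\<close> under \<open>D\<close>.\<close>
  have L2: "\<And>n. integrable M (\<lambda>\<omega>. (norm (weighted_average \<gamma> X n \<omega>))\<^sup>2)"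
      "(\<lambda>n. \<integral>\<omega>. (norm (weighted_average \<gamma> X n \<omega>))\<^sup>2 \<partial>M) \<longlonglongrightarrow> 0"
    by (rule weighted_average_orthogonal_L2[OF X_meas X_sq X_var[THEN eq_refl] X_orth \<gamma>01 \<gamma>_sum \<gamma>_lim];
        assumption)+
  \<comment> \<open>Convergence of the squared norms in mean gives one subsequence that serves
    almost every path.\<close>
  obtain r where r: "strict_mono r"
    and "AE \<omega> in M. (\<lambda>n. (norm (weighted_average \<gamma> X (r n) \<omega>))\<^sup>2) \<longlonglongrightarrow> 0"
    using tendsto_L1_AE_subseq[of M "\<lambda>n \<omega>. (norm (weighted_average \<gamma> X n \<omega>))\<^sup>2"] L2 by auto
  then have noise: "AE \<omega> in M. (\<lambda>n. weighted_average \<gamma> X (r n) \<omega>) \<longlonglongrightarrow> 0"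
    by (simp add: power_tendsto_0_iff tendsto_norm_zero_iff)

  \<comment> \<open>Passage to a single path and to the objective\<close>
  have stationary: "AE \<omega> in M. (\<lambda>t. Wt t \<omega>) \<longlonglongrightarrow> Wstar \<longrightarrow> - g \<in> regular_subdifferential \<psi> Wstar"
    using traj noise AE_sample[OF smooth] AE_sample[OF G_eq]
  proof eventually_elim
    case (elim \<omega>)
    show ?case
    proof
      assume lim: "(\<lambda>t. Wt t \<omega>) \<longlonglongrightarrow> Wstar"
      show "- g \<in> regular_subdifferential \<psi> Wstar"
      proof (rule rmda_trajectory_regular_subgradient[where L = L, OF elim(1) ninf proper eta_pos c_range c_sum'
              _ beta_alpha _ _ r _ lim osc])
        show "weighted_average \<gamma> X (Suc n) \<omega> =
            (1 - rmda_beta (Suc n) * \<eta> (Suc n) / rmda_alpha \<eta> (Suc n)) *\<^sub>R weighted_average \<gamma> X n \<omega> +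
            (rmda_beta (Suc n) * \<eta> (Suc n) / rmda_alpha \<eta> (Suc n)) *\<^sub>R
              (gradient (f (\<xi> (Suc n) \<omega>)) Wstar - g)" for n
          using elim(4) by (simp add: \<gamma>_def[symmetric] X_def Y_def)
      qed (use elim \<gamma>_sum in \<open>simp_all add: \<gamma>_def\<close>)
    qed
  qed
  have "- g \<in> regular_subdifferential \<psi> Wstar"
  proof (rule ccontr)
    assume "- g \<notin> regular_subdifferential \<psi> Wstar"
    with stationary have "AE \<omega> in M. \<not> (\<lambda>t. Wt t \<omega>) \<longlonglongrightarrow> Wstar" by simp
    then have "\<P>(\<omega> in M. (\<lambda>t. Wt t \<omega>) \<longlonglongrightarrow> Wstar) = 0"
      \<comment> \<open>Should the event lie outside \<open>sets M\<close>, its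
        \<open>measure\<close> is 0 by default, so either case contradicts
        \<open>event_pos\<close>.\<close>
      by (cases "{\<omega> \<in> space M. (\<lambda>t. Wt t \<omega>) \<longlonglongrightarrow> Wstar} \<in> sets M")
        (simp_all add: M.prob_Collect_eq_0 measure_notin_sets)
    with event_pos show False by contradiction
  qed
  \<comment> \<open>The gradient \<open>g\<close> of the expected loss and the subgradient
    \<open>- g\<close> of \<psi> sum to 0.\<close>
  from regular_subdifferential_add_smooth[OF gderiv this ninf]
  have "Wstar \<in> stationary_points D f \<psi>"
    by (simp add: stationary_points_def objective_def[abs_def])
  \<comment> \<open>Stationarity does not depend on \<open>\<omega>\<close>, so numerator and
    denominator of the conditional probability coincide, and the latter is nonzero.\<close>
  then show ?thesis
    using event_pos by (simp add: cond_prob_def)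
qed

end
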